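(* Let $K,N\ge 1$ be integers, $P_{\rm T}>0$, $\sigma^2>0$, let $\mathbf H\in\mathbb R^{2K\times 2N}$, $\mathbf s\in\mathbb R^{2K}$, $\boldsymbol\Lambda\in\mathbb R^{2K\times 2K}$, $\beta_k$ and $\mathbf m_k$ ($k\in\mathcal K=\{1,\dots,K\}$) be as in the context, with $\mathbf H\mathbf H^T$ invertible. Consider the optimization problem $$\max_{\mathbf x,\boldsymbol\delta,\gamma_1,\dots,\gamma_K}\ \min_{k\in\mathcal K}\ \frac{\gamma_k^2}{\beta_k^2\|\mathbf m_k\|_2^2P_{\rm T}/N+\sigma^2}$$ over $\mathbf x\in\mathbb R^{2N}$, $\boldsymbol\delta\in\mathbb R^{2K}$, $\gamma_1,\dots,\gamma_K\in\mathbb R$, subject to $$\mathbf H\mathbf x=\boldsymbol\Gamma(\mathbf s+\boldsymbol\Lambda\boldsymbol\delta),\qquad \|\mathbf x\|_2^2=P_{\rm T},\qquad \boldsymbol\delta\succeq\mathbf 0,\qquad \gamma_k>0\ \ \forall k\in\mathcal K,$$ where $\boldsymbol\Gamma=\mathbf I_2\otimes{\rm diag}\{\gamma_1,\dots,\gamma_K\}$. Put $\mathbf H^{\dagger}=\mathbf H^T(\mathbf H\mathbf H^T)^{-1}$, $\tau_k=\sqrt{\beta_k^2\|\mathbf m_k\|_2^2P_{\rm T}/N+\sigma^2}$ and $\boldsymbol\Theta=\mathbf I_2\otimes{\rm diag}\{\tau_1,\dots,\tau_K\}$. Then the following $(\mathbf x^\star,\boldsymbol\delta^\star,\gamma_1^\star,\dots,\gamma_K^\star)$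 achieves the optimum of this problem: $$\boldsymbol\delta^\star=\arg\min_{\boldsymbol\delta\succeq\mathbf 0}\big\|\sqrt N\,\mathbf H^\dagger\boldsymbol\Theta(\mathbf s+\boldsymbol\Lambda\boldsymbol\delta)\big\|_2^2,$$ $$\gamma_k^\star=\sqrt{\frac{P_{\rm T}}{\|\mathbf H^\dagger\boldsymbol\Theta(\mathbf s+\boldsymbol\Lambda\boldsymbol\delta^\star)\|_2^2}}\cdot\tau_k,\quad k\in\mathcal K,$$ $$\mathbf x^\star=\sqrt{\frac{P_{\rm T}}{\|\mathbf H^\dagger\boldsymbol\Theta(\mathbf s+\boldsymbol\Lambda\boldsymbol\delta^\star)\|_2^2}}\ \mathbf H^\dagger\boldsymbol\Theta(\mathbf s+\boldsymbol\Lambda\boldsymbol\delta^\star).$$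
   Context: Notation: $\mathbf v\succeq\mathbf 0$ means all entries of $\mathbf v$ are nonnegative; $\otimes$ is the Kronecker product; $\mathbf I_n$ is the $n\times n$ identity. Symbols: $M>2$ is an integer and $s_1,\dots,s_K\in\mathbb C$ are points of an $M$-PSK constellation ($M$ equally spaced points on the unit circle). With $\mathbf s_{\rm c}=[s_1,\dots,s_K]^T$, set $\mathbf s=[\Re(\mathbf s_{\rm c})^T,\Im(\mathbf s_{\rm c})^T]^T\in\mathbb R^{2K}$. Constructive interference region: for each $k$, $\mu_k,\nu_k\in\mathbb C$ are the unit direction vectors of the two boundary rays, starting at $s_k$, of the constructive interference region of $s_k$. These rays are parallel to the two decision boundaries of $s_k$, so $\{\mu_k,\nu_k\}=\{s_ke^{i\pi/M},\,s_ke^{-i\pi/M}\}$. Set $$\boldsymbol\Lambda=\begin{bmatrix}{\rm diag}\{\Re(\mu_1),\dots,\Re(\mu_K)\}&{\rm diag}\{\Re(\nu_1),\dots,\Re(\nu_K)\}\\ {\rm diag}\{\Im(\mu_1),\dots,\Im(\mu_K)\}&{\rm diag}\{\Im(\nu_1),\dots,\Im(\nu_K)\}\end{bmatrix}.$$ Channel: $\bar{\mathbf h}_1,\dots,\bar{\mathbf h}_K\in\mathbb C^{N}$ are given vectors, $\bar{\mathbf H}\in\mathbb C^{K\times N}$ is the matrix with $k$-th row $\bar{\mathbf h}_k^T$, and $$\mathbf H=\begin{bmatrix}\Re(\bar{\mathbf H})&-\Im(\bar{\mathbf H})\\ \Im(\bar{\mathbf H})&\Re(\bar{\mathbf H})\end{bmatrix}\in\mathbb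 R^{2K\times 2N}.$$ For each $k$, $\beta_k=\sqrt{1-\alpha_k^2}$ with $\alpha_k\in[-1,1]$ a given correlation coefficient, and $\mathbf m_k$ is a given real vector (of length $F_{\rm vh}N$ for a fixed positive integer $F_{\rm vh}$) with nonnegative entries. *)

theory Defs
  imports "HOL-Analysis.Analysis"
begin

(* Vectors of length 2K and 2N are indexed by 2 \<times> 'k and 2 \<times> 'n, where (1, k) is the k-th entry
   of the upper block and (2, k) the k-th entry of the lower block. *)

definition stack_vec :: "'a ^ 'k \<Rightarrow> 'a ^ 'k \<Rightarrow> 'a ^ (2 \<times> 'k)" where
  "stack_vec u v = (\<chi> i. if fst i = 1 then u $ snd i else v $ snd i)"

definition block_matrix ::
  "'a ^ 'n ^ 'm \<Rightarrow> 'a ^ 'n ^ 'm \<Rightarrow> 'a ^ 'n ^ 'm \<Rightarrow> 'a ^ 'n ^ 'm \<Rightarrow> 'a ^ (2 \<times> 'n) ^ (2 \<times> 'm)" where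
  "block_matrix A B C D =
     (\<chi> i j. (if fst i = 1 then (if fst j = 1 then A else B) else (if fst j = 1 then C else D))
              $ snd i $ snd j)"

definition diag_matrix :: "'a::zero ^ 'k \<Rightarrow> 'a ^ 'k ^ 'k" where
  "diag_matrix v = (\<chi> i j. if i = j then v $ i else 0)"

definition kronecker :: "'a::times ^ 'n ^ 'm \<Rightarrow> 'a ^ 'q ^ 'p \<Rightarrow> 'a ^ ('n \<times> 'q) ^ ('m \<times> 'p)" where
  "kronecker A B = (\<chi> i j. A $ fst i $ fst j * B $ snd i $ snd j)"

definition Re_vec :: "complex ^ 'k \<Rightarrow> real ^ 'k" where
  "Re_vec v = (\<chi> k. Re (v $ k))"

definition Im_vec :: "complex ^ 'k \<Rightarrow> real ^ 'k" where
  "Im_vec v = (\<chi> k. Im (v $ k))"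

(* The phase offset \<phi> is arbitrary: only equal spacing on the unit circle is required. *)
definition psk_constellation :: "nat \<Rightarrow> real \<Rightarrow> complex set" where
  "psk_constellation M \<phi> = {cis (\<phi> + 2 * pi * real m / real M) | m. m < M}"

definition real_symbols :: "complex ^ 'k \<Rightarrow> real ^ (2 \<times> 'k)" where
  "real_symbols s = stack_vec (Re_vec s) (Im_vec s)"

definition real_channel :: "complex ^ 'n ^ 'k \<Rightarrow> real ^ (2 \<times> 'n) ^ (2 \<times> 'k)" where
  "real_channel H =
     block_matrix (map_matrix Re H) (- map_matrix Im H) (map_matrix Im H) (map_matrix Re H)"

definition boundary_matrix :: "complex ^ 'k \<Rightarrow> complex ^ 'k \<Rightarrow> real ^ (2 \<times> 'k) ^ (2 \<times> 'k)" where
  "boundary_matrix \<mu> \<nu> =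
     block_matrix (diag_matrix (Re_vec \<mu>)) (diag_matrix (Re_vec \<nu>))
                  (diag_matrix (Im_vec \<mu>)) (diag_matrix (Im_vec \<nu>))"

definition right_pinv :: "real ^ 'n ^ 'm \<Rightarrow> real ^ 'm ^ 'n" where
  "right_pinv H = transpose H ** matrix_inv (H ** transpose H)"

definition double_diag :: "real ^ 'k \<Rightarrow> real ^ (2 \<times> 'k) ^ (2 \<times> 'k)" where
  "double_diag g = kronecker (mat 1 :: real ^ 2 ^ 2) (diag_matrix g)"

(* For real vectors, 0 \<le> \<delta> is the componentwise order. *)
definition feasible ::
  "real ^ (2 \<times> 'n::finite) ^ (2 \<times> 'k::finite) \<Rightarrow> real ^ (2 \<times> 'k) \<Rightarrow> real ^ (2 \<times> 'k) ^ (2 \<times> 'k) \<Rightarrow> real \<Rightarrow>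
   (real ^ (2 \<times> 'n)) \<times> (real ^ (2 \<times> 'k)) \<times> (real ^ 'k) \<Rightarrow> bool" where
  "feasible H s \<Lambda> P = (\<lambda>(x, \<delta>, \<gamma>).
     H *v x = double_diag \<gamma> *v (s + \<Lambda> *v \<delta>) \<and> (norm x)\<^sup>2 = P \<and> 0 \<le> \<delta> \<and> (\<forall>k. \<gamma> $ k > 0))"

end

(* Since s_k is a positive multiple of mu_k + nu_k, we have s + Lambda delta = Lambda (e + delta)
   with e > 0. Lambda commutes with the diagonal scaling Gamma, so replacing every gamma_k of a
   feasible point by the smaller value r tau_k, where r^2 is the objective value, only enlarges
   e + delta and hence keeps delta >= 0. Therefore Gamma can be taken to be r Theta, and since the
   pseudo-inverse gives the minimum-norm solution of H x = y, the power constraint bounds r by the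
   minimal norm of H^+ Theta (s + Lambda delta). That minimum is attained because
   H^+ Theta Lambda is injective. *)
theory Submission
  imports Defs
begin

lemma sum_UNIV_prod:
  "(\<Sum>j\<in>(UNIV :: ('a::finite \<times> 'b::finite) set). f j) = (\<Sum>a\<in>UNIV. \<Sum>b\<in>UNIV. f (a, b))"
  by (simp add: sum.cartesian_product)

lemma double_diag_mult_vec: "double_diag g *v v = (\<chi> i. g $ snd i * v $ i)"
proof -
  have "(double_diag g *v v) $ (a, b) = g $ b * v $ (a, b)" for a b
    by (simp add: matrix_vector_mult_def sum_UNIV_prod double_diag_def kronecker_def
        diag_matrix_def mat_def if_distrib[of "\<lambda>x. x * _"] if_distrib[of "\<lambda>x. _ * x"]
        cong: if_cong)
  then show ?thesis
    by (simp add: vec_eq_iff)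
qed

text \<open>Passing to one complex number per user reduces questions about the real block matrix to
  real combinations of \<open>\<mu> $ k\<close> and \<open>\<nu> $ k\<close>.\<close>

lemma boundary_matrix_mult_vec:
  "boundary_matrix \<mu> \<nu> *v \<delta> =
     real_symbols (\<chi> k. of_real (\<delta> $ (1, k)) * \<mu> $ k + of_real (\<delta> $ (2, k)) * \<nu> $ k)"
    (is "?l = ?r")
proof -
  have "?l $ (1, k) = ?r $ (1, k)" "?l $ (2, k) = ?r $ (2, k)" for k
    by (simp_all add: matrix_vector_mult_def sum_UNIV_prod sum_2 boundary_matrix_def block_matrix_def
        diag_matrix_def real_symbols_def stack_vec_def Re_vec_def Im_vec_def
        if_distrib[of "\<lambda>x. x * _"] cong: if_cong)
  then have "?l $ (a, k) = ?r $ (a, k)" for a k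
    using exhaust_2[of a] by auto
  then show ?thesis
    by (simp add: vec_eq_iff)
qed

lemma psk_constellation_nonzero: "z \<in> psk_constellation M \<phi> \<Longrightarrow> z \<noteq> 0"
  by (auto simp: psk_constellation_def)

text \<open>The set equation leaves open which direction is which, but the sum is symmetric, and
  \<open>cis t + cis (- t)\<close> is \<open>2 * cos t\<close>.\<close>

lemma rotated_pair_sum:
  assumes "{\<mu>, \<nu>} = {z * cis t, z * cis (- t)}"
  shows "\<mu> + \<nu> = of_real (2 * cos t) * z"
  using assms by (auto simp: doubleton_eq_iff complex_eq_iff algebra_simps)

text \<open>After cancelling \<open>z\<close>, the real part forces
  \<open>(p + q) * cos t = 0\<close> and the imaginary part \<open>(p - q) * sin t = 0\<close>. This
  yields the injectivity of \<Lambda>.\<close>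

lemma rotated_pair_independent:
  assumes "{\<mu>, \<nu>} = {z * cis t, z * cis (- t)}" "z \<noteq> 0" "sin t \<noteq> 0" "cos t \<noteq> 0"
    and "of_real a * \<mu> + of_real b * \<nu> = 0"
  shows "a = 0 \<and> b = 0"
proof -
  have *: "p = 0 \<and> q = 0" if "of_real p * (z * cis t) + of_real q * (z * cis (- t)) = 0" for p q :: real
  proof -
    have "z * (of_real p * cis t + of_real q * cis (- t)) = 0"
      using that by (simp add: algebra_simps)
    then have "of_real p * cis t + of_real q * cis (- t) = 0"
      using assms(2) by simp
    then have "(p + q) * cos t = 0" "(p - q) * sin t = 0"
      by (simp_all add: complex_eq_iff algebra_simps)
    then show ?thesis using assms(3,4) by simp
  qed
  from assms(1) consider "\<mu> = z * cis t" "\<nu> = z * cis (- t)" | "\<mu> = z * cis (- t)" "\<nu> = z * cis t"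
    by (auto simp: doubleton_eq_iff)
  then show ?thesis
    using * assms(5) by cases (auto simp: add.commute)
qed

lemma matrix_mult_matrix_inv:
  fixes A :: "'a::semiring_1 ^ 'n ^ 'm"
  assumes "invertible A"
  shows "A ** matrix_inv A = mat 1"
  using assms unfolding invertible_def matrix_inv_def by (rule someI2_ex) blast

lemma right_pinv_right_inverse:
  assumes "invertible (H ** transpose H)"
  shows "H *v (right_pinv H *v y) = y"
proof -
  have "H ** right_pinv H = mat 1"
    using assms by (simp add: right_pinv_def matrix_mul_assoc matrix_mult_matrix_inv)
  then show ?thesis
    by (simp add: matrix_vector_mul_assoc)
qed

text \<open>The pseudo-inverse picks the minimum-norm solution: \<open>y\<close> lies in the row
  space of \<open>H\<close> and has the same image as \<open>x\<close>, so \<open>x - y\<close> is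
  orthogonal to \<open>y\<close>, and Cauchy-Schwarz finishes.\<close>

lemma norm_right_pinv_le:
  fixes H :: "real ^ 'n ^ 'm"
  assumes "invertible (H ** transpose H)"
  shows "norm (right_pinv H *v (H *v x)) \<le> norm x"
proof -
  define y where "y = right_pinv H *v (H *v x)"
  define z where "z = matrix_inv (H ** transpose H) *v (H *v x)"
  have y: "y = transpose H *v z"
    by (simp add: y_def z_def right_pinv_def flip: matrix_vector_mul_assoc)
  have "H *v y = H *v x"
    by (simp add: y_def right_pinv_right_inverse[OF assms])
  then have "y \<bullet> y = x \<bullet> y"
    by (metis y dot_lmul_matrix inner_commute transpose_matrix_vector)
  then have "norm y * norm y \<le> norm x * norm y"
    using norm_cauchy_schwarz[of x y] by (simp flip: power2_eq_square add: power2_norm_eq_inner)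
  then show ?thesis
    unfolding y_def[symmetric] by (cases "norm y = 0") auto
qed

text \<open>Both matrices consist of diagonal blocks, and user k's real and imaginary parts carry
  the same real factor \<open>g $ k\<close>.\<close>

lemma double_diag_boundary_matrix_commute:
  "double_diag g *v (boundary_matrix \<mu> \<nu> *v \<delta>) = boundary_matrix \<mu> \<nu> *v (double_diag g *v \<delta>)"
  unfolding double_diag_mult_vec boundary_matrix_mult_vec real_symbols_def stack_vec_def
    Re_vec_def Im_vec_def vec_eq_iff
  by (simp add: distrib_left)

lemma real_symbols_eq_0_iff: "real_symbols z = 0 \<longleftrightarrow> z = 0"
proof
  assume "real_symbols z = 0"
  then have "real_symbols z $ (1, k) = 0" "real_symbols z $ (2, k) = 0" for k
    by simp_all
  then show "z = 0"
    by (simp add: real_symbols_def stack_vec_def Re_vec_def Im_vec_def vec_eq_iff complex_eq_iff)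
qed (simp add: real_symbols_def stack_vec_def Re_vec_def Im_vec_def vec_eq_iff)

lemma closed_nonneg_vec: "closed {x :: real ^ 'n. 0 \<le> x}"
proof -
  have "{x :: real ^ 'n. 0 \<le> x} = (\<Inter>i. {x. 0 \<le> x $ i})"
    by (auto simp: less_eq_vec_def)
  moreover have "closed {x :: real ^ 'n. 0 \<le> x $ i}" for i
    by (intro closed_Collect_le continuous_intros)
  ultimately show ?thesis
    by auto
qed

text \<open>\<open>S\<close> may be unbounded, so compactness is replaced by closedness: an
  injective linear map sends \<open>S\<close> to a closed set, which contains a point nearest to
  \<open>- b\<close>.\<close>

lemma norm_affine_attains_inf:
  fixes f :: "'a::euclidean_space \<Rightarrow> 'b::euclidean_space"
  assumes "closed S" "S \<noteq> {}" "linear f" "inj f"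
  obtains x where "x \<in> S" "\<And>y. y \<in> S \<Longrightarrow> norm (b + f x) \<le> norm (b + f y)"
proof -
  have "closed (f ` S)"
    using assms by (intro closed_injective_linear_image)
  then obtain z where z: "z \<in> f ` S" "\<And>y. y \<in> f ` S \<Longrightarrow> dist (- b) z \<le> dist (- b) y"
    using assms(2) distance_attains_inf[of "f ` S" "- b"] by (metis image_is_empty)
  have "dist (- b) y = norm (b + y)" for y
    by (simp add: dist_norm norm_minus_commute add.commute)
  with z that show thesis
    by auto
qed

theorem proposition2:
  fixes M :: nat and \<phi> :: real
    and s\<^sub>c \<mu> \<nu> :: "complex ^ 'k"
    and h :: "'k \<Rightarrow> complex ^ 'n"
    and \<alpha> \<beta> :: "'k \<Rightarrow> real"
    and m :: "'k \<Rightarrow> real ^ ('f::finite \<times> 'n)"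
    and P\<^sub>T \<sigma> :: real
    and H :: "real ^ (2 \<times> 'n) ^ (2 \<times> 'k)"
    and H\<^sub>d :: "real ^ (2 \<times> 'k) ^ (2 \<times> 'n)"
    and s :: "real ^ (2 \<times> 'k)"
    and \<Lambda> \<Theta> :: "real ^ (2 \<times> 'k) ^ (2 \<times> 'k)"
    and \<tau> :: "real ^ 'k"
  assumes "M > 2"
    and "\<And>k. s\<^sub>c $ k \<in> psk_constellation M \<phi>"
    and "s = real_symbols s\<^sub>c"
    and "\<And>k. {\<mu> $ k, \<nu> $ k} = {s\<^sub>c $ k * cis (pi / real M), s\<^sub>c $ k * cis (- (pi / real M))}"
    and "\<Lambda> = boundary_matrix \<mu> \<nu>"
    and "H = real_channel (\<chi> k. h k)"
    and "invertible (H ** transpose H)"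
    and "\<And>k. - 1 \<le> \<alpha> k \<and> \<alpha> k \<le> 1"
    and "\<And>k. \<beta> k = sqrt (1 - (\<alpha> k)\<^sup>2)"
    and "\<And>k. 0 \<le> m k"
    and "P\<^sub>T > 0"
    and "\<sigma>\<^sup>2 > 0"
    and "H\<^sub>d = right_pinv H"
    and "\<tau> = (\<chi> k. sqrt ((\<beta> k)\<^sup>2 * (norm (m k))\<^sup>2 * P\<^sub>T / real CARD('n) + \<sigma>\<^sup>2))"
    and "\<Theta> = double_diag \<tau>"
  shows "(\<exists>\<delta>. is_arg_min (\<lambda>\<delta>. (norm (sqrt (real CARD('n)) *\<^sub>R ((H\<^sub>d ** \<Theta>) *v (s + \<Lambda> *v \<delta>))))\<^sup>2)
              (\<lambda>\<delta>. 0 \<le> \<delta>) \<delta>) \<and>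
    (\<forall>\<delta>s \<gamma>s xs.
       is_arg_min (\<lambda>\<delta>. (norm (sqrt (real CARD('n)) *\<^sub>R ((H\<^sub>d ** \<Theta>) *v (s + \<Lambda> *v \<delta>))))\<^sup>2)
         (\<lambda>\<delta>. 0 \<le> \<delta>) \<delta>s \<longrightarrow>
       \<gamma>s = (\<chi> k. sqrt (P\<^sub>T / (norm ((H\<^sub>d ** \<Theta>) *v (s + \<Lambda> *v \<delta>s)))\<^sup>2) * \<tau> $ k) \<longrightarrow>
       xs = sqrt (P\<^sub>T / (norm ((H\<^sub>d ** \<Theta>) *v (s + \<Lambda> *v \<delta>s)))\<^sup>2) *\<^sub>R ((H\<^sub>d ** \<Theta>) *v (s + \<Lambda> *v \<delta>s)) \<longrightarrow>
       is_arg_max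
         (\<lambda>(x, \<delta>, \<gamma>). MIN k. (\<gamma> $ k)\<^sup>2 /
            ((\<beta> k)\<^sup>2 * (norm (m k))\<^sup>2 * P\<^sub>T / real CARD('n) + \<sigma>\<^sup>2))
         (feasible H s \<Lambda> P\<^sub>T) (xs, \<delta>s, \<gamma>s))"
proof -
  define c where "c = cos (pi / real M)"
  \<comment> \<open>Since \<open>\<mu> $ k + \<nu> $ k\<close> is \<open>2 * c\<close> times the
    k-th symbol, the weight \<open>1 / (2 * c)\<close> on both directions recovers that
    symbol.\<close>
  define e :: "real ^ (2 \<times> 'k)" where "e = (\<chi> i. 1 / (2 * c))"
  define A where "A = H\<^sub>d ** \<Theta>"
  define w where "w \<delta> = A *v (s + \<Lambda> *v \<delta>)" for \<delta>
  \<comment> \<open>\<open>M > 2\<close> puts the angle strictly below pi/2, so the cosine, and with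
    it every entry of \<open>e\<close>, is positive.\<close>
  have angle: "0 < pi / real M" "pi / real M < pi / 2"
    using \<open>M > 2\<close> by (simp_all add: field_simps)
  then have c_pos: "c > 0"
    by (simp add: c_def cos_gt_zero)
  have sin_pos: "sin (pi / real M) > 0"
    using angle pi_gt_zero by (intro sin_gt_zero) linarith+
  have e_pos: "e $ i > 0" for i
    using c_pos by (simp add: e_def)
  have s_eq: "s = \<Lambda> *v e"
  proof -
    have "of_real (1 / (2 * c)) * \<mu> $ k + of_real (1 / (2 * c)) * \<nu> $ k = s\<^sub>c $ k" for k
    proof -
      have "of_real (1 / (2 * c)) * (\<mu> $ k + \<nu> $ k) = s\<^sub>c $ k"
        using c_pos by (simp add: rotated_pair_sum[OF assms(4)] flip: c_def)
      then show ?thesis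
        by (simp add: distrib_left)
    qed
    then have "(\<chi> k. of_real (1 / (2 * c)) * \<mu> $ k + of_real (1 / (2 * c)) * \<nu> $ k) = s\<^sub>c"
      by (simp add: vec_eq_iff)
    then show ?thesis
      unfolding assms(3) \<open>\<Lambda> = _\<close> boundary_matrix_mult_vec by (simp add: e_def)
  qed
  have \<Lambda>_ker: "d = 0" if "\<Lambda> *v d = 0" for d
  proof -
    have eq: "of_real (d $ (1, k)) * \<mu> $ k + of_real (d $ (2, k)) * \<nu> $ k = 0" for k
      using that unfolding \<open>\<Lambda> = _\<close> boundary_matrix_mult_vec real_symbols_eq_0_iff
      by (simp add: vec_eq_iff)
    have "d $ (1, k) = 0 \<and> d $ (2, k) = 0" for k
      using rotated_pair_independent[OF assms(4) _ _ _ eq[of k]] psk_constellation_nonzero[OF assms(2)]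
        sin_pos c_pos by (auto simp: c_def)
    then have "d $ (i, k) = 0" for i k
      using exhaust_2[of i] by auto
    then show ?thesis
      by (simp add: vec_eq_iff)
  qed
  have \<tau>_sq: "(\<beta> k)\<^sup>2 * (norm (m k))\<^sup>2 * P\<^sub>T / real CARD('n) + \<sigma>\<^sup>2 = (\<tau> $ k)\<^sup>2"
    and \<tau>_pos: "\<tau> $ k > 0" for k
  proof -
    have "(\<beta> k)\<^sup>2 * (norm (m k))\<^sup>2 * P\<^sub>T / real CARD('n) + \<sigma>\<^sup>2 > 0"
      using \<open>P\<^sub>T > 0\<close> \<open>\<sigma>\<^sup>2 > 0\<close> by (intro add_nonneg_pos) auto
    then show "(\<beta> k)\<^sup>2 * (norm (m k))\<^sup>2 * P\<^sub>T / real CARD('n) + \<sigma>\<^sup>2 = (\<tau> $ k)\<^sup>2" "\<tau> $ k > 0"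
      by (simp_all add: assms(14))
  qed
  have \<tau>_nz: "\<tau> $ k \<noteq> 0" for k
    using \<tau>_pos[of k] by simp
  have H_Hd: "H *v (H\<^sub>d *v y) = y" for y
    by (simp add: assms(13) right_pinv_right_inverse[OF assms(7)])
  have HA: "H *v (A *v y) = \<Theta> *v y" for y
    by (simp add: A_def H_Hd flip: matrix_vector_mul_assoc)
  \<comment> \<open>\<open>H\<close> undoes the pseudo-inverse, leaving \<Theta>, whose diagonal
    entries are nonzero.\<close>
  have A_ker: "y = 0" if "A *v y = 0" for y
  proof -
    have "\<Theta> *v y = 0"
      using HA[of y] that by simp
    then show ?thesis
      by (simp add: assms(15) double_diag_mult_vec vec_eq_iff \<tau>_nz)
  qed
  have w_eq: "w \<delta> = A *v (\<Lambda> *v (e + \<delta>))" for \<delta>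
    by (simp add: w_def s_eq matrix_vector_right_distrib)
  \<comment> \<open>This keeps the divisions by the norm of \<open>w\<close> meaningful:
    \<open>e + \<delta>\<close> has positive entries, and both \<open>\<Lambda>\<close> and
    \<open>A\<close> have trivial kernel.\<close>
  have w_pos: "norm (w \<delta>) > 0" if "0 \<le> \<delta>" for \<delta>
  proof -
    have "(e + \<delta>) $ i > 0" for i
      using e_pos[of i] that by (cases i) (simp add: less_eq_vec_def add_pos_nonneg)
    then have "e + \<delta> \<noteq> 0"
      by (metis less_irrefl zero_index)
    then show ?thesis
      using A_ker \<Lambda>_ker by (auto simp: w_eq)
  qed
  \<comment> \<open>The positive factor sqrt N and the squaring are monotone on norms, so they do
    not affect the minimizers.\<close>
  have argmin_iff: "is_arg_min (\<lambda>\<delta>. (norm (sqrt (real CARD('n)) *\<^sub>R w \<delta>))\<^sup>2) (\<lambda>\<delta>. 0 \<le> \<delta>) \<delta>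
      \<longleftrightarrow> 0 \<le> \<delta> \<and> (\<forall>y\<ge>0. norm (w \<delta>) \<le> norm (w y))" for \<delta>
    by (auto simp: is_arg_min_linorder power_mult_distrib)
  have "\<exists>\<delta>. 0 \<le> \<delta> \<and> (\<forall>y\<ge>0. norm (w \<delta>) \<le> norm (w y))"
  proof -
    \<comment> \<open>\<open>w\<close> is affine, with constant part \<open>A *v s\<close> and
      linear part \<open>A ** \<Lambda>\<close>.\<close>
    have lin: "linear (\<lambda>\<delta>. (A ** \<Lambda>) *v \<delta>)"
      by simp
    moreover have "inj (\<lambda>\<delta>. (A ** \<Lambda>) *v \<delta>)"
      unfolding linear_injective_0[OF lin] using A_ker \<Lambda>_ker by (auto simp flip: matrix_vector_mul_assoc)
    ultimately obtain \<delta> where "\<delta> \<in> {\<delta>. 0 \<le> \<delta>}"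
      "\<And>y. y \<in> {\<delta>. 0 \<le> \<delta>} \<Longrightarrow> norm (A *v s + (A ** \<Lambda>) *v \<delta>) \<le> norm (A *v s + (A ** \<Lambda>) *v y)"
      using norm_affine_attains_inf[OF closed_nonneg_vec, of "\<lambda>\<delta>. (A ** \<Lambda>) *v \<delta>" "A *v s"] by blast
    then show ?thesis
      by (auto simp: w_def matrix_vector_right_distrib matrix_vector_mul_assoc)
  qed
  moreover have "is_arg_max (\<lambda>(x, \<delta>, \<gamma>). MIN k. (\<gamma> $ k)\<^sup>2 / (\<tau> $ k)\<^sup>2) (feasible H s \<Lambda> P\<^sub>T) (xs, \<delta>s, \<gamma>s)"
    if \<delta>s: "0 \<le> \<delta>s" "\<And>y. 0 \<le> y \<Longrightarrow> norm (w \<delta>s) \<le> norm (w y)"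
      and \<gamma>s: "\<gamma>s = (\<chi> k. sqrt (P\<^sub>T / (norm (w \<delta>s))\<^sup>2) * \<tau> $ k)"
      and xs: "xs = sqrt (P\<^sub>T / (norm (w \<delta>s))\<^sup>2) *\<^sub>R w \<delta>s" for \<delta>s \<gamma>s xs
  proof -
    \<comment> \<open>The common scale of the candidate: \<open>\<gamma>s\<close> is
      \<open>q\<close> times \<tau> and \<open>xs\<close> is \<open>q *\<^sub>R w \<delta>s\<close>,
      so the power is exactly \<open>P\<^sub>T\<close>.\<close>
    define q where "q = sqrt (P\<^sub>T / (norm (w \<delta>s))\<^sup>2)"
    have q_sq: "q\<^sup>2 = P\<^sub>T / (norm (w \<delta>s))\<^sup>2" and q_pos: "q > 0"
      using \<open>P\<^sub>T > 0\<close> w_pos[OF \<delta>s(1)] by (simp_all add: q_def)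
    have "feasible H s \<Lambda> P\<^sub>T (xs, \<delta>s, \<gamma>s)"
    proof -
      have "H *v xs = q *\<^sub>R (\<Theta> *v (s + \<Lambda> *v \<delta>s))"
        by (simp add: xs matrix_vector_mult_scaleR HA flip: q_def) (simp add: w_def HA)
      also have "\<dots> = double_diag \<gamma>s *v (s + \<Lambda> *v \<delta>s)"
        by (simp add: \<gamma>s assms(15) double_diag_mult_vec vec_eq_iff flip: q_def)
      finally show ?thesis
        using \<delta>s(1) q_pos \<tau>_pos w_pos[OF \<delta>s(1)]
        by (simp add: feasible_def \<gamma>s power_mult_distrib q_sq xs flip: q_def)
    qed
    moreover have "(MIN k. (\<gamma> $ k)\<^sup>2 / (\<tau> $ k)\<^sup>2) \<le> q\<^sup>2" if "feasible H s \<Lambda> P\<^sub>T (x, \<delta>, \<gamma>)" for x \<delta> \<gamma>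
    proof -
      have x: "H *v x = double_diag \<gamma> *v (s + \<Lambda> *v \<delta>)" "(norm x)\<^sup>2 = P\<^sub>T" "0 \<le> \<delta>" "\<And>k. \<gamma> $ k > 0"
        using that by (auto simp: feasible_def)
      define t where "t = (MIN k. (\<gamma> $ k)\<^sup>2 / (\<tau> $ k)\<^sup>2)"
      define r where "r = sqrt t"
      \<comment> \<open>A minimum over finitely many users is attained, so it inherits positivity
        from the individual ratios.\<close>
      have "t \<in> range (\<lambda>k. (\<gamma> $ k)\<^sup>2 / (\<tau> $ k)\<^sup>2)"
        unfolding t_def by (intro Min_in) auto
      then have "t > 0"
        using x(4) \<tau>_pos by (auto intro!: divide_pos_pos zero_less_power)
      then have r: "r > 0" "r\<^sup>2 = t"
        by (simp_all add: r_def)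
      have ratio: "\<gamma> $ k / (r * \<tau> $ k) \<ge> 1" for k
      proof -
        have "r\<^sup>2 \<le> (\<gamma> $ k / \<tau> $ k)\<^sup>2"
          unfolding r t_def by (simp add: power_divide)
        then have "r \<le> \<gamma> $ k / \<tau> $ k"
          by (rule power2_le_imp_le) (use x(4)[of k] \<tau>_pos[of k] in simp)
        then show ?thesis
          using r(1) \<tau>_pos[of k] by (simp add: field_simps)
      qed
      \<comment> \<open>Chosen to solve \<open>r * \<tau> $ k * (e + \<delta>') $ i = \<gamma> $ k *
        (e + \<delta>) $ i\<close> with \<open>k = snd i\<close>. By \<open>ratio\<close> the
        multiplier is at least 1, so \<open>e + \<delta>'\<close> dominates
        \<open>e + \<delta>\<close>, hence also \<open>e\<close>.\<close>
      define \<delta>' where "\<delta>' = (\<chi> i. \<gamma> $ snd i / (r * \<tau> $ snd i) * (e + \<delta>) $ i) - e"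
      have "0 \<le> \<delta>'"
      proof -
        have "e $ i \<le> \<gamma> $ snd i / (r * \<tau> $ snd i) * (e + \<delta>) $ i" for i
        proof -
          have "1 * e $ i \<le> \<gamma> $ snd i / (r * \<tau> $ snd i) * (e + \<delta>) $ i"
          proof (intro mult_mono ratio)
            show "e $ i \<le> (e + \<delta>) $ i" "0 \<le> e $ i"
              using x(3) e_pos[of i] by (cases i; simp add: less_eq_vec_def)+
            show "0 \<le> \<gamma> $ snd i / (r * \<tau> $ snd i)"
              using ratio[of "snd i"] by linarith
          qed
          then show ?thesis by simp
        qed
        then show ?thesis
          by (simp add: \<delta>'_def less_eq_vec_def)
      qed
      have "double_diag \<gamma> *v (e + \<delta>) = r *\<^sub>R (\<Theta> *v (e + \<delta>'))"
        using r(1) by (simp add: \<delta>'_def assms(15) double_diag_mult_vec vec_eq_iff \<tau>_nz)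
      \<comment> \<open>Writing \<open>s\<close> as \<open>\<Lambda> *v e\<close> lets \<Lambda> be
        pulled out in front of both diagonal scalings, where the previous identity applies.\<close>
      then have "double_diag \<gamma> *v (s + \<Lambda> *v \<delta>) = r *\<^sub>R (\<Theta> *v (s + \<Lambda> *v \<delta>'))"
        unfolding s_eq matrix_vector_right_distrib[symmetric] assms(15) \<open>\<Lambda> = _\<close>
          double_diag_boundary_matrix_commute
        by (simp add: matrix_vector_mult_scaleR)
      then have "H\<^sub>d *v (H *v x) = r *\<^sub>R w \<delta>'"
        by (simp add: x(1) w_def A_def matrix_vector_mult_scaleR matrix_vector_mul_assoc)
      \<comment> \<open>\<open>r *\<^sub>R w \<delta>'\<close> is the minimum-norm vector with the
        same image under \<open>H\<close> as \<open>x\<close>, so it needs no more power than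
        \<open>x\<close>.\<close>
      then have "r * norm (w \<delta>') \<le> norm x"
        using norm_right_pinv_le[OF assms(7), of x] r(1) by (simp add: assms(13))
      moreover have "r * norm (w \<delta>s) \<le> r * norm (w \<delta>')"
        using \<delta>s(2)[OF \<open>0 \<le> \<delta>'\<close>] r(1) by simp
      ultimately have "r * norm (w \<delta>s) \<le> norm x"
        by linarith
      then have "(r * norm (w \<delta>s))\<^sup>2 \<le> (norm x)\<^sup>2"
        using r(1) by (intro power_mono) auto
      \<comment> \<open>Here \<open>t\<close> times the squared norm of \<open>w \<delta>s\<close>
        is at most \<open>P\<^sub>T\<close>; dividing gives the bound by
        \<open>q\<^sup>2\<close>.\<close>
      then show ?thesis
        using w_pos[OF \<delta>s(1)] by (simp add: q_sq x(2) power_mult_distrib r(2) field_simps flip: t_def)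
    qed
    \<comment> \<open>The candidate balances all users: every ratio equals \<open>q\<^sup>2\<close>,
      so the bound is met with equality.\<close>
    moreover have "(MIN k. (\<gamma>s $ k)\<^sup>2 / (\<tau> $ k)\<^sup>2) = q\<^sup>2"
    proof -
      have "(\<gamma>s $ k)\<^sup>2 / (\<tau> $ k)\<^sup>2 = q\<^sup>2" for k
        using \<tau>_pos[of k] by (simp add: \<gamma>s power_mult_distrib flip: q_def)
      then show ?thesis
        by simp
    qed
    ultimately show ?thesis
      by (auto simp: is_arg_max_linorder)
  qed
  ultimately show ?thesis
    unfolding \<tau>_sq A_def[symmetric] w_def[symmetric] argmin_iff by blast
qed

end
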